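(* Let $R$ be a commutative ring and $X$ a directed space. For all $n\ge 2$, the algebra operation of $HA_n(X)$ is the zero multiplication: for all $x,y\in HA_n(X)$, $x\times y=0$.
   Context: A directed space (d-space) is a topological space $X$ with a set $dX$ of continuous paths $[0,1]\to X$ (the d-paths) containing all constant paths, closed under precomposition with continuous non-decreasing maps $[0,1]\to[0,1]$, and closed under concatenation. $\Delta_n=\{(t_0,\dots,t_n): t_j\ge 0,\ \sum_j t_j=1\}$ is the standard simplex, with face inclusions $\delta_k:\Delta_{n-1}\to\Delta_n$ (insert $0$ at position $k$) and degeneracies $\sigma_k:\Delta_n\to\Delta_{n-1}$, $0\le k<n$, $(t_0,\dots,t_n)\mapsto(t_0,\dots,t_k+t_{k+1},\dots,t_n)$. For $i\ge 1$, an $i$-path in $X$ is a continuous map $p:[0,1]\times\Delta_{i-1}\to X$ such that $p(\cdot,t)$ is a d-path for every $t\in\Delta_{i-1}$. For $a,b\in X$, an $i$-trace from $a$ to $b$ is a class of $i$-paths $p$ with $p(0,t)=a$ and $p(1,t)=b$ for all $t$, modulo reparametrization in the first coordinate (the equivalence relation generated by $p\sim p\circ(\varphi\times \mathrm{Id})$ with $\varphi:[0,1]\to[0,1]$ continuous, non-decreasing and surjective). The maps $d_j(p)=p\circ(\mathrm{Id}\times\delta_j)$ (from $(i+1)$-paths to $i$-paths, $0\le j\le i$) and $s_k(p)=p\circ(\mathrm{Id}\times\sigma_k)$ (from $i$-paths to $(i+1)$-paths, $0\le k\le i-1$) induce maps on traces preserving start and end points. $R_i[X]$, $i\ge1$,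 is the free $R$-module on all $i$-traces of $X$, with bilinear product determined on basis elements by $p\times q=p*q$ (concatenation in the first coordinate) if the end point of $p$ is the start point of $q$, and $p\times q=0$ otherwise. Extending $d_j,s_k$ linearly, $R[X]=(R_{i+1}[X])_{i\ge0}$ (with $R_{i+1}[X]$ in degree $i$) is a simplicial object in the category of non-unital associative $R$-algebras. For a simplicial algebra $S$ with faces $d^n_j:S_n\to S_{n-1}$, its Moore normalization $NS$ is $(NS)_n=\bigcap_{j=0}^{n-1}\ker d^n_j$ with differential $\partial^n=(-1)^n d^n_n:(NS)_n\to(NS)_{n-1}$ (zero for $n=0$). The image of $\partial^{n+1}$ is a two-sided ideal, and $H_n(NS)=\ker\partial^n/\mathrm{Im}\,\partial^{n+1}$ is an algebra with the induced multiplication. The directed homology algebras are $HA_{n}(X)=H_{n-1}(NR[X])$ for $n\ge 1$. *)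

theory Defs
  imports "HOL-Homology.Homology" "HOL-Library.Poly_Mapping"
begin

section \<open>Directed spaces\<close>

text \<open>Functions on the unit interval (and on products of it with a simplex) are taken extensional,
  so that equality in HOL is equality on the domain.\<close>

definition concat_path :: "(real \<Rightarrow> 'a) \<Rightarrow> (real \<Rightarrow> 'a) \<Rightarrow> real \<Rightarrow> 'a" where
  "concat_path p q = (\<lambda>s\<in>{0..1}. if s \<le> 1/2 then p (2 * s) else q (2 * s - 1))"

definition d_space :: "'a topology \<Rightarrow> (real \<Rightarrow> 'a) set \<Rightarrow> bool" where
  "d_space X dX \<longleftrightarrow>
     (\<forall>p\<in>dX. pathin X p \<and> p \<in> extensional {0..1}) \<and>
     (\<forall>a\<in>topspace X. (\<lambda>s\<in>{0..1}. a) \<in> dX) \<and>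
     (\<forall>p\<in>dX. \<forall>\<phi>. continuous_on {0..1} \<phi> \<and> mono_on {0..1} \<phi> \<and> \<phi> ` {0..1} \<subseteq> {0..1}
        \<longrightarrow> (\<lambda>s\<in>{0..1}. p (\<phi> s)) \<in> dX) \<and>
     (\<forall>p\<in>dX. \<forall>q\<in>dX. p 1 = q 0 \<longrightarrow> concat_path p q \<in> dX)"


section \<open>Higher paths and traces\<close>

text \<open>An \<open>i\<close>-path is parametrised by the simplex of dimension \<open>i - 1\<close>; all notions below are
  meant for \<open>i \<ge> 1\<close>.\<close>

type_synonym 'a ipath = "real \<times> (nat \<Rightarrow> real) \<Rightarrow> 'a"
type_synonym 'a trace = "'a ipath set"

definition ipath_dom :: "nat \<Rightarrow> (real \<times> (nat \<Rightarrow> real)) set" where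
  "ipath_dom i = {0..1} \<times> standard_simplex (i - 1)"

definition ipaths :: "'a topology \<Rightarrow> (real \<Rightarrow> 'a) set \<Rightarrow> nat \<Rightarrow> 'a ipath set" where
  "ipaths X dX i =
     {p. continuous_map
           (prod_topology (subtopology euclideanreal {0..1})
              (subtopology (powertop_real UNIV) (standard_simplex (i - 1)))) X p \<and>
         p \<in> extensional (ipath_dom i) \<and>
         (\<forall>t\<in>standard_simplex (i - 1). (\<lambda>s. p (s, t)) \<in> dX)}"

definition ipaths_between ::
  "'a topology \<Rightarrow> (real \<Rightarrow> 'a) set \<Rightarrow> nat \<Rightarrow> 'a \<Rightarrow> 'a \<Rightarrow> 'a ipath set" where
  "ipaths_between X dX i a b =
     {p \<in> ipaths X dX i. \<forall>t\<in>standard_simplex (i - 1). p (0, t) = a \<and> p (1, t) = b}"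

definition reparametrizes ::
  "'a topology \<Rightarrow> (real \<Rightarrow> 'a) set \<Rightarrow> nat \<Rightarrow> 'a ipath \<Rightarrow> 'a ipath \<Rightarrow> bool" where
  "reparametrizes X dX i p q \<longleftrightarrow>
     p \<in> ipaths X dX i \<and> q \<in> ipaths X dX i \<and>
     (\<exists>\<phi>. continuous_on {0..1} \<phi> \<and> mono_on {0..1} \<phi> \<and> \<phi> ` {0..1} = {0..1} \<and>
          q = (\<lambda>(s, t)\<in>ipath_dom i. p (\<phi> s, t)))"

definition trace_rel ::
  "'a topology \<Rightarrow> (real \<Rightarrow> 'a) set \<Rightarrow> nat \<Rightarrow> ('a ipath \<times> 'a ipath) set" where
  "trace_rel X dX i =
     {(p, q). p \<in> ipaths X dX i \<and> q \<in> ipaths X dX i \<and> equivclp (reparametrizes X dX i) p q}"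

definition traces_between ::
  "'a topology \<Rightarrow> (real \<Rightarrow> 'a) set \<Rightarrow> nat \<Rightarrow> 'a \<Rightarrow> 'a \<Rightarrow> 'a trace set" where
  "traces_between X dX i a b = ipaths_between X dX i a b // trace_rel X dX i"

definition traces :: "'a topology \<Rightarrow> (real \<Rightarrow> 'a) set \<Rightarrow> nat \<Rightarrow> 'a trace set" where
  "traces X dX i = (\<Union>a\<in>topspace X. \<Union>b\<in>topspace X. traces_between X dX i a b)"

definition composable ::
  "'a topology \<Rightarrow> (real \<Rightarrow> 'a) set \<Rightarrow> nat \<Rightarrow> 'a trace \<Rightarrow> 'a trace \<Rightarrow> bool" where
  "composable X dX i P Q \<longleftrightarrow>
     (\<exists>a\<in>topspace X. \<exists>b\<in>topspace X. \<exists>c\<in>topspace X.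
        P \<in> traces_between X dX i a b \<and> Q \<in> traces_between X dX i b c)"

definition ipath_concat :: "nat \<Rightarrow> 'a ipath \<Rightarrow> 'a ipath \<Rightarrow> 'a ipath" where
  "ipath_concat i p q =
     (\<lambda>(s, t)\<in>ipath_dom i. if s \<le> 1/2 then p (2 * s, t) else q (2 * s - 1, t))"

definition trace_concat ::
  "'a topology \<Rightarrow> (real \<Rightarrow> 'a) set \<Rightarrow> nat \<Rightarrow> 'a trace \<Rightarrow> 'a trace \<Rightarrow> 'a trace" where
  "trace_concat X dX i P Q = (\<Union>p\<in>P. \<Union>q\<in>Q. trace_rel X dX i `` {ipath_concat i p q})"

text \<open>The \<open>j\<close>-th face takes \<open>(i + 1)\<close>-paths to \<open>i\<close>-paths, for \<open>j \<le> i\<close>.\<close>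

definition ipath_face :: "nat \<Rightarrow> nat \<Rightarrow> 'a ipath \<Rightarrow> 'a ipath" where
  "ipath_face i j p = (\<lambda>(s, t)\<in>ipath_dom i. p (s, simplical_face j t))"

definition trace_face ::
  "'a topology \<Rightarrow> (real \<Rightarrow> 'a) set \<Rightarrow> nat \<Rightarrow> nat \<Rightarrow> 'a trace \<Rightarrow> 'a trace" where
  "trace_face X dX i j P = (\<Union>p\<in>P. trace_rel X dX i `` {ipath_face i j p})"


section \<open>The simplicial algebra of traces\<close>

text \<open>The free module on the \<open>i\<close>-traces consists of the finitely supported functions on traces
  with support in \<^term>\<open>traces X dX i\<close>. The sort \<open>{comm_ring, comm_monoid_mult}\<close> describes
  commutative rings with unit; unlike \<open>comm_ring_1\<close> it does not exclude the zero ring.\<close>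

definition trace_module ::
  "'a topology \<Rightarrow> (real \<Rightarrow> 'a) set \<Rightarrow> nat \<Rightarrow>
     ('a trace \<Rightarrow>\<^sub>0 'r::{comm_ring,comm_monoid_mult}) set" where
  "trace_module X dX i = {x. Poly_Mapping.keys x \<subseteq> traces X dX i}"

definition trace_times ::
  "'a topology \<Rightarrow> (real \<Rightarrow> 'a) set \<Rightarrow> nat \<Rightarrow>
     ('a trace \<Rightarrow>\<^sub>0 'r::{comm_ring,comm_monoid_mult}) \<Rightarrow> ('a trace \<Rightarrow>\<^sub>0 'r) \<Rightarrow> ('a trace \<Rightarrow>\<^sub>0 'r)" where
  "trace_times X dX i x y =
     (\<Sum>P\<in>Poly_Mapping.keys x. \<Sum>Q\<in>Poly_Mapping.keys y.
        if composable X dX i P Q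
        then Poly_Mapping.single (trace_concat X dX i P Q)
               (Poly_Mapping.lookup x P * Poly_Mapping.lookup y Q)
        else 0)"

definition module_face ::
  "'a topology \<Rightarrow> (real \<Rightarrow> 'a) set \<Rightarrow> nat \<Rightarrow> nat \<Rightarrow>
     ('a trace \<Rightarrow>\<^sub>0 'r::{comm_ring,comm_monoid_mult}) \<Rightarrow> ('a trace \<Rightarrow>\<^sub>0 'r)" where
  "module_face X dX i j x =
     (\<Sum>P\<in>Poly_Mapping.keys x.
        Poly_Mapping.single (trace_face X dX i j P) (Poly_Mapping.lookup x P))"


section \<open>Moore normalization and homology of a simplicial algebra\<close>

text \<open>A simplicial algebra enters through its carriers \<open>S n\<close>, its faces \<open>d n j\<close> from \<open>S n\<close>
  to \<open>S (n - 1)\<close> and its products \<open>mul n\<close>; the degeneracies play no role in the normalization.\<close>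

definition moore_normalization ::
  "(nat \<Rightarrow> 'b::ab_group_add set) \<Rightarrow> (nat \<Rightarrow> nat \<Rightarrow> 'b \<Rightarrow> 'b) \<Rightarrow> nat \<Rightarrow> 'b set" where
  "moore_normalization S d n = {x \<in> S n. \<forall>j<n. d n j x = 0}"

definition moore_differential ::
  "(nat \<Rightarrow> nat \<Rightarrow> 'b \<Rightarrow> 'b) \<Rightarrow> nat \<Rightarrow> 'b \<Rightarrow> 'b::ab_group_add" where
  "moore_differential d n x =
     (if n = 0 then 0 else if even n then d n n x else - d n n x)"

definition moore_cycles ::
  "(nat \<Rightarrow> 'b::ab_group_add set) \<Rightarrow> (nat \<Rightarrow> nat \<Rightarrow> 'b \<Rightarrow> 'b) \<Rightarrow> nat \<Rightarrow> 'b set" where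
  "moore_cycles S d n = {x \<in> moore_normalization S d n. moore_differential d n x = 0}"

definition moore_boundaries ::
  "(nat \<Rightarrow> 'b::ab_group_add set) \<Rightarrow> (nat \<Rightarrow> nat \<Rightarrow> 'b \<Rightarrow> 'b) \<Rightarrow> nat \<Rightarrow> 'b set" where
  "moore_boundaries S d n = moore_differential d (n + 1) ` moore_normalization S d (n + 1)"

definition moore_homology_rel ::
  "(nat \<Rightarrow> 'b::ab_group_add set) \<Rightarrow> (nat \<Rightarrow> nat \<Rightarrow> 'b \<Rightarrow> 'b) \<Rightarrow> nat \<Rightarrow> ('b \<times> 'b) set" where
  "moore_homology_rel S d n =
     {(x, y). x \<in> moore_cycles S d n \<and> y \<in> moore_cycles S d n \<and> x - y \<in> moore_boundaries S d n}"

definition moore_homology ::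
  "(nat \<Rightarrow> 'b::ab_group_add set) \<Rightarrow> (nat \<Rightarrow> nat \<Rightarrow> 'b \<Rightarrow> 'b) \<Rightarrow> nat \<Rightarrow> 'b set set" where
  "moore_homology S d n = moore_cycles S d n // moore_homology_rel S d n"

definition moore_homology_zero ::
  "(nat \<Rightarrow> 'b::ab_group_add set) \<Rightarrow> (nat \<Rightarrow> nat \<Rightarrow> 'b \<Rightarrow> 'b) \<Rightarrow> nat \<Rightarrow> 'b set" where
  "moore_homology_zero S d n = moore_homology_rel S d n `` {0}"

definition moore_homology_times ::
  "(nat \<Rightarrow> 'b::ab_group_add set) \<Rightarrow> (nat \<Rightarrow> nat \<Rightarrow> 'b \<Rightarrow> 'b) \<Rightarrow> (nat \<Rightarrow> 'b \<Rightarrow> 'b \<Rightarrow> 'b) \<Rightarrow>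
     nat \<Rightarrow> 'b set \<Rightarrow> 'b set \<Rightarrow> 'b set" where
  "moore_homology_times S d mul n A B =
     (\<Union>x\<in>A. \<Union>y\<in>B. moore_homology_rel S d n `` {mul n x y})"


section \<open>Directed homology algebras\<close>

text \<open>Degree \<open>n\<close> of the simplicial algebra \<open>R[X]\<close> is the module on the \<open>(n + 1)\<close>-traces, so
  its faces \<open>d n j\<close> go from \<open>(n + 1)\<close>-traces to \<open>n\<close>-traces. The algebras \<open>HA X dX n\<close> are meant
  for \<open>n \<ge> 1\<close>.\<close>

definition RX :: "'a topology \<Rightarrow> (real \<Rightarrow> 'a) set \<Rightarrow> nat \<Rightarrow>
    ('a trace \<Rightarrow>\<^sub>0 'r::{comm_ring,comm_monoid_mult}) set" where
  "RX X dX n = trace_module X dX (n + 1)"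

definition RX_face :: "'a topology \<Rightarrow> (real \<Rightarrow> 'a) set \<Rightarrow> nat \<Rightarrow> nat \<Rightarrow>
    ('a trace \<Rightarrow>\<^sub>0 'r::{comm_ring,comm_monoid_mult}) \<Rightarrow> ('a trace \<Rightarrow>\<^sub>0 'r)" where
  "RX_face X dX n j = module_face X dX n j"

definition RX_times :: "'a topology \<Rightarrow> (real \<Rightarrow> 'a) set \<Rightarrow> nat \<Rightarrow>
    ('a trace \<Rightarrow>\<^sub>0 'r::{comm_ring,comm_monoid_mult}) \<Rightarrow> ('a trace \<Rightarrow>\<^sub>0 'r) \<Rightarrow> ('a trace \<Rightarrow>\<^sub>0 'r)" where
  "RX_times X dX n = trace_times X dX (n + 1)"

definition HA :: "'a topology \<Rightarrow> (real \<Rightarrow> 'a) set \<Rightarrow> nat \<Rightarrow>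
    ('a trace \<Rightarrow>\<^sub>0 'r::{comm_ring,comm_monoid_mult}) set set" where
  "HA X dX n = moore_homology (RX X dX) (RX_face X dX) (n - 1)"

definition HA_zero :: "'a topology \<Rightarrow> (real \<Rightarrow> 'a) set \<Rightarrow> nat \<Rightarrow>
    ('a trace \<Rightarrow>\<^sub>0 'r::{comm_ring,comm_monoid_mult}) set" where
  "HA_zero X dX n = moore_homology_zero (RX X dX) (RX_face X dX) (n - 1)"

definition HA_times :: "'a topology \<Rightarrow> (real \<Rightarrow> 'a) set \<Rightarrow> nat \<Rightarrow>
    ('a trace \<Rightarrow>\<^sub>0 'r::{comm_ring,comm_monoid_mult}) set \<Rightarrow> ('a trace \<Rightarrow>\<^sub>0 'r) set \<Rightarrow>
    ('a trace \<Rightarrow>\<^sub>0 'r) set" where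
  "HA_times X dX n = moore_homology_times (RX X dX) (RX_face X dX) (RX_times X dX) (n - 1)"

end

theory Submission
  imports Defs
begin

text \<open>For Moore cycles \<open>x\<close>, \<open>y\<close> of degree \<open>m \<ge> 1\<close> in a simplicial algebra, the element
  \<open>z = s\<^sub>m\<^sub>-\<^sub>1 x \<times> s\<^sub>m y - s\<^sub>m (x \<times> y)\<close> has \<open>d\<^sub>j z = 0\<close> for \<open>j \<le> m\<close> and \<open>d\<^sub>m\<^sub>+\<^sub>1 z = - (x \<times> y)\<close>:
  every face except \<open>d\<^sub>m\<close> kills one of the two factors of the first term, and the second term
  corrects \<open>d\<^sub>m\<close>. Hence all products of cycles are boundaries. Faces and degeneracies of traces
  are both pullbacks along maps of simplices, and every such pullback preserves endpoints and
  commutes with concatenation, so it induces a homomorphism of trace algebras.\<close>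

section \<open>Products of Moore cycles\<close>

text \<open>Only those simplicial identities are assumed that the argument needs. Indices follow
  \<^const>\<open>moore_normalization\<close>: \<open>d n j\<close> goes from \<open>S n\<close> to \<open>S (n - 1)\<close>, and \<open>s n k\<close> from \<open>S n\<close> to
  \<open>S (n + 1)\<close>.\<close>

locale face_degeneracy_algebra =
  fixes S :: "nat \<Rightarrow> 'b::ab_group_add set"
    and d s :: "nat \<Rightarrow> nat \<Rightarrow> 'b \<Rightarrow> 'b"
    and mul :: "nat \<Rightarrow> 'b \<Rightarrow> 'b \<Rightarrow> 'b"
  assumes zero_closed: "0 \<in> S n"
    and diff_closed: "x \<in> S n \<Longrightarrow> y \<in> S n \<Longrightarrow> x - y \<in> S n"
    and mul_closed: "x \<in> S n \<Longrightarrow> y \<in> S n \<Longrightarrow> mul n x y \<in> S n"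
    and mul_zero_left: "mul n 0 y = 0"
    and mul_zero_right: "mul n x 0 = 0"
    and face_diff: "d n j (x - y) = d n j x - d n j y"
    and face_mul: "\<lbrakk>x \<in> S (Suc n); y \<in> S (Suc n); j \<le> Suc n\<rbrakk>
      \<Longrightarrow> d (Suc n) j (mul (Suc n) x y) = mul n (d (Suc n) j x) (d (Suc n) j y)"
    and degen_closed: "x \<in> S n \<Longrightarrow> k \<le> n \<Longrightarrow> s n k x \<in> S (Suc n)"
    and degen_diff: "s n k (x - y) = s n k x - s n k y"
    and face_degen_less: "\<lbrakk>x \<in> S n; j < k; k \<le> n\<rbrakk>
      \<Longrightarrow> d (Suc n) j (s n k x) = s (n - 1) (k - 1) (d n j x)"
    and face_degen_same: "\<lbrakk>x \<in> S n; k \<le> n\<rbrakk> \<Longrightarrow> d (Suc n) k (s n k x) = x"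
    and face_degen_Suc: "\<lbrakk>x \<in> S n; k \<le> n\<rbrakk> \<Longrightarrow> d (Suc n) (Suc k) (s n k x) = x"
    and face_degen_greater: "\<lbrakk>x \<in> S n; Suc k < j; j \<le> Suc n\<rbrakk>
      \<Longrightarrow> d (Suc n) j (s n k x) = s (n - 1) k (d n (j - 1) x)"
begin

lemma face_zero: "d n j 0 = 0"
  using face_diff[of n j 0 0] by simp

lemma degen_zero: "s n k 0 = 0"
  using degen_diff[of n k 0 0] by simp

lemma uminus_closed: "x \<in> S n \<Longrightarrow> - x \<in> S n"
  using diff_closed[OF zero_closed, of x n] by simp

lemma face_uminus: "d n j (- x) = - d n j x"
  using face_diff[of n j 0 x] by (simp add: face_zero)

text \<open>The differential is the last face up to sign, so in positive degree the cycle condition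
  adds the one face that the normalization leaves out. In degree 0 the differential is zero by
  convention, hence the index \<open>Suc n\<close>.\<close>

lemma moore_cycles_iff:
  "x \<in> moore_cycles S d (Suc n) \<longleftrightarrow> x \<in> S (Suc n) \<and> (\<forall>j\<le>Suc n. d (Suc n) j x = 0)"
  by (auto simp: moore_cycles_def moore_normalization_def moore_differential_def le_Suc_eq
      less_Suc_eq_le)

lemma zero_moore_cycle: "0 \<in> moore_cycles S d n"
  by (simp add: moore_cycles_def moore_normalization_def moore_differential_def zero_closed face_zero)

lemma diff_moore_boundary:
  assumes "x \<in> moore_boundaries S d n" "y \<in> moore_boundaries S d n"
  shows "x - y \<in> moore_boundaries S d n"
proof -
  obtain u v where "u \<in> moore_normalization S d (n + 1)" "v \<in> moore_normalization S d (n + 1)"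
    and xy: "x = moore_differential d (n + 1) u" "y = moore_differential d (n + 1) v"
    using assms by (auto simp: moore_boundaries_def)
  then have "u - v \<in> moore_normalization S d (n + 1)"
    by (auto simp: moore_normalization_def diff_closed face_diff)
  moreover have "x - y = moore_differential d (n + 1) (u - v)"
    by (simp add: xy moore_differential_def face_diff)
  ultimately show ?thesis
    unfolding moore_boundaries_def by blast
qed

text \<open>Boundaries are closed under subtraction, so \<open>w - v\<close> is a boundary exactly
  when \<open>0 - v\<close> is one. The classes of \<open>w\<close> and \<open>0\<close> are thus
  compared directly as sets.\<close>

lemma moore_homology_class_boundary:
  assumes w: "w \<in> moore_cycles S d n" "w \<in> moore_boundaries S d n"
  shows "moore_homology_rel S d n `` {w} = moore_homology_zero S d n"
proof -
  have "0 \<in> moore_boundaries S d n"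
    using diff_moore_boundary[OF w(2) w(2)] by simp
  then have neg: "- v \<in> moore_boundaries S d n" if "v \<in> moore_boundaries S d n" for v
    using diff_moore_boundary that by fastforce
  have "w - v \<in> moore_boundaries S d n \<longleftrightarrow> 0 - v \<in> moore_boundaries S d n" for v
  proof
    assume "w - v \<in> moore_boundaries S d n"
    from diff_moore_boundary[OF this w(2)] show "0 - v \<in> moore_boundaries S d n"
      by simp
  next
    assume "0 - v \<in> moore_boundaries S d n"
    from diff_moore_boundary[OF w(2) neg[OF this]] show "w - v \<in> moore_boundaries S d n"
      by simp
  qed
  then show ?thesis
    using w(1) zero_moore_cycle
    by (auto simp: moore_homology_zero_def moore_homology_rel_def)
qed

lemma mul_moore_cycle:
  assumes "x \<in> moore_cycles S d (Suc n)" "y \<in> moore_cycles S d (Suc n)"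
  shows "mul (Suc n) x y \<in> moore_cycles S d (Suc n)"
  using assms by (simp add: moore_cycles_iff mul_closed face_mul mul_zero_left)

lemma mul_moore_boundary:
  assumes x: "x \<in> moore_cycles S d (Suc n)" and y: "y \<in> moore_cycles S d (Suc n)"
  shows "mul (Suc n) x y \<in> moore_boundaries S d (Suc n)"
proof -
  \<comment> \<open>The degree is \<open>m\<close>, and \<open>n\<close> is its predecessor, the
    index of the degeneracy applied to \<open>x\<close>. Such an index exists only in positive
    degree.\<close>
  define m where "m = Suc n"
  define xy where "xy = mul m x y"
  define u where "u = mul (Suc m) (s m n x) (s m m y)"
  define z where "z = u - s m m xy"
  have mem: "x \<in> S m" "y \<in> S m" "xy \<in> S m"
    and faces: "\<And>j. j \<le> m \<Longrightarrow> d m j x = 0" "\<And>j. j \<le> m \<Longrightarrow> d m j y = 0"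
      "\<And>j. j \<le> m \<Longrightarrow> d m j xy = 0"
    using x y mul_moore_cycle[OF x y] by (auto simp: m_def xy_def moore_cycles_iff)
  have n: "n \<le> m" and n': "Suc n = m"
    by (auto simp: m_def)
  have smem: "s m n x \<in> S (Suc m)" "s m m y \<in> S (Suc m)" "s m m xy \<in> S (Suc m)"
    using mem n by (auto intro: degen_closed)
  \<comment> \<open>Below \<open>m\<close> a face commutes past the last degeneracy and meets a
    vanishing face of \<open>v\<close>. This serves both for \<open>y\<close> and for
    \<open>xy\<close>.\<close>
  have low: "d (Suc m) j (s m m v) = 0"
    if "v \<in> S m" "\<And>j. j \<le> m \<Longrightarrow> d m j v = 0" "j < m" for v j
    using face_degen_less[OF that(1,3)] that by (simp add: degen_zero)
  have z_face: "d (Suc m) j z = (if j = Suc m then - xy else 0)" if j: "j \<le> Suc m" for j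
  proof -
    have u_face: "d (Suc m) j u = mul m (d (Suc m) j (s m n x)) (d (Suc m) j (s m m y))"
      unfolding u_def using smem j by (intro face_mul)
    consider "j < m" | "j = m" | "j = Suc m"
      using j by linarith
    then show ?thesis
    proof cases
      case 1
      then show ?thesis
        using low[OF mem(2) faces(2)] low[OF mem(3) faces(3)]
        by (simp add: z_def face_diff u_face mul_zero_right)
    next
      \<comment> \<open>Face \<open>m\<close> undoes all three degeneracies, so \<open>u\<close> and
        the correction term both become \<open>xy\<close> and cancel.\<close>
      case 2
      then show ?thesis
        using u_face face_degen_Suc[OF mem(1) n] face_degen_same[OF mem(2), of m]
          face_degen_same[OF mem(3), of m]
        by (simp add: z_def face_diff n' xy_def)
    next
      case 3
      \<comment> \<open>The last face commutes past the degeneracy of index \<open>n\<close> and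
        becomes face \<open>m\<close> of the cycle \<open>x\<close>. This removes \<open>u\<close>;
        the correction term alone survives, as \<open>- xy\<close>.\<close>
      have "d (Suc m) (Suc m) (s m n x) = 0"
        using face_degen_greater[OF mem(1), of n "Suc m"] by (simp add: n' faces degen_zero)
      then show ?thesis
        using 3 u_face face_degen_Suc[OF mem(3), of m]
        by (simp add: z_def face_diff mul_zero_left)
    qed
  qed
  have z_mem: "z \<in> S (Suc m)"
    unfolding z_def u_def using smem by (intro diff_closed mul_closed)
  \<comment> \<open>The last face of \<open>z\<close> is \<open>- xy\<close> and the differential in
    degree \<open>m + 1\<close> carries the sign (-1)^(m+1). The factor (-1)^m makes the outcome
    exactly \<open>xy\<close>.\<close>
  define z' where "z' = (if even m then z else - z)"
  have "z' \<in> moore_normalization S d (m + 1)"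
    using z_mem z_face by (simp add: z'_def moore_normalization_def uminus_closed face_uminus)
  moreover have "moore_differential d (m + 1) z' = xy"
    using z_face[of "Suc m"] by (simp add: z'_def moore_differential_def face_uminus)
  ultimately show ?thesis
    unfolding moore_boundaries_def xy_def m_def by force
qed

lemma moore_homology_times_zero:
  assumes A: "A \<in> moore_homology S d (Suc n)" and B: "B \<in> moore_homology S d (Suc n)"
  shows "moore_homology_times S d mul (Suc n) A B = moore_homology_zero S d (Suc n)"
proof -
  \<comment> \<open>With \<open>0\<close> a boundary, the homology relation is reflexive on cycles,
    so no class is empty. This matters because the product is a union over representatives, and an
    empty class would yield the empty set instead of the zero class.\<close>
  have "0 \<in> moore_boundaries S d (Suc n)"
    using mul_moore_boundary[OF zero_moore_cycle zero_moore_cycle] by (simp add: mul_zero_left)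
  then have nonempty: "C \<noteq> {}" and cycles: "C \<subseteq> moore_cycles S d (Suc n)"
    if "C \<in> moore_homology S d (Suc n)" for C
    using that by (auto simp: moore_homology_def moore_homology_rel_def quotient_def)
  have "moore_homology_rel S d (Suc n) `` {mul (Suc n) x y} = moore_homology_zero S d (Suc n)"
    if "x \<in> A" "y \<in> B" for x y
    using that cycles[OF A] cycles[OF B]
    by (intro moore_homology_class_boundary mul_moore_cycle mul_moore_boundary) auto
  then show ?thesis
    using nonempty[OF A] nonempty[OF B] by (auto simp: moore_homology_times_def)
qed

end


section \<open>Linear extensions and the trace product\<close>

text \<open>The linear map of free modules induced by \<open>f\<close>, the common form of
  \<open>module_face\<close> and of the degeneracies. Linearity and functoriality are thereby proved
  once for both.\<close>

definition pushforward ::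
  "('k \<Rightarrow> 'l) \<Rightarrow> ('k \<Rightarrow>\<^sub>0 'r::ab_group_add) \<Rightarrow> ('l \<Rightarrow>\<^sub>0 'r)" where
  "pushforward f x = (\<Sum>k\<in>Poly_Mapping.keys x. Poly_Mapping.single (f k) (Poly_Mapping.lookup x k))"

text \<open>Keys outside the support contribute \<open>single\<close> with coefficient 0. A larger
  index set allows arguments with different supports, and their sum, in which keys may cancel, to be
  expanded over one common set.\<close>

lemma pushforward_superset:
  assumes "finite K" "Poly_Mapping.keys x \<subseteq> K"
  shows "pushforward f x = (\<Sum>k\<in>K. Poly_Mapping.single (f k) (Poly_Mapping.lookup x k))"
  unfolding pushforward_def using assms
  by (intro sum.mono_neutral_left) (auto simp: in_keys_iff)

lemma poly_mapping_expand: "x = pushforward (\<lambda>k. k) x"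
  by (rule poly_mapping_eqI)
     (auto simp: pushforward_def lookup_sum lookup_single when_def in_keys_iff)

lemma pushforward_single: "pushforward f (Poly_Mapping.single k c) = Poly_Mapping.single (f k) c"
  by (subst pushforward_superset[of "{k}"]) auto

lemma pushforward_zero: "pushforward f 0 = 0"
  by (simp add: pushforward_def)

lemma pushforward_add: "pushforward f (x + y) = pushforward f x + pushforward f y"
proof -
  have "finite (Poly_Mapping.keys x \<union> Poly_Mapping.keys y)"
    by simp
  note * = pushforward_superset[OF this]
  show ?thesis
    by (simp add: * keys_add lookup_add single_add sum.distrib)
qed

lemma pushforward_diff: "pushforward f (x - y) = pushforward f x - pushforward f y"
  using pushforward_add[of f "x - y" y] by simp

lemma pushforward_sum: "pushforward f (sum g I) = (\<Sum>i\<in>I. pushforward f (g i))"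
  using sum_comp_morphism[of "pushforward f" g I]
  by (simp add: pushforward_zero pushforward_add o_def)

lemma pushforward_pushforward: "pushforward f (pushforward g x) = pushforward (f \<circ> g) x"
  unfolding pushforward_def[of g] pushforward_def[of "f \<circ> g"]
  by (simp add: pushforward_sum pushforward_single)

lemma pushforward_cong:
  "(\<And>k. k \<in> Poly_Mapping.keys x \<Longrightarrow> f k = g k) \<Longrightarrow> pushforward f x = pushforward g x"
  by (simp add: pushforward_def)

lemma keys_pushforward: "Poly_Mapping.keys (pushforward f x) \<subseteq> f ` Poly_Mapping.keys x"
  unfolding pushforward_def by (rule order_trans[OF keys_sum]) auto

section \<open>Bilinearity of the trace product\<close>

lemma trace_times_superset:
  assumes "finite A" "Poly_Mapping.keys x \<subseteq> A" "finite B" "Poly_Mapping.keys y \<subseteq> B"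
  shows "trace_times X dX i x y = (\<Sum>P\<in>A. \<Sum>Q\<in>B.
    if composable X dX i P Q
    then Poly_Mapping.single (trace_concat X dX i P Q)
           (Poly_Mapping.lookup x P * Poly_Mapping.lookup y Q)
    else 0)"
proof -
  have inner: "(\<Sum>Q\<in>Poly_Mapping.keys y.
      if composable X dX i P Q
      then Poly_Mapping.single (trace_concat X dX i P Q)
             (Poly_Mapping.lookup x P * Poly_Mapping.lookup y Q) else 0) =
     (\<Sum>Q\<in>B. if composable X dX i P Q
      then Poly_Mapping.single (trace_concat X dX i P Q)
             (Poly_Mapping.lookup x P * Poly_Mapping.lookup y Q) else 0)" for P
    using assms by (intro sum.mono_neutral_left) (auto simp: in_keys_iff)
  show ?thesis
    unfolding trace_times_def inner using assms
    by (intro sum.mono_neutral_left ballI sum.neutral) (auto simp: in_keys_iff)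
qed

lemma trace_times_zero: "trace_times X dX i 0 y = 0" "trace_times X dX i x 0 = 0"
  by (simp_all add: trace_times_def)

lemma trace_times_add_left:
  "trace_times X dX i (x + x') y = trace_times X dX i x y + trace_times X dX i x' y"
proof -
  have "finite (Poly_Mapping.keys x \<union> Poly_Mapping.keys x')"
    by simp
  note * = trace_times_superset[OF this _ finite_keys order_refl]
  show ?thesis
    by (auto simp: * keys_add lookup_add distrib_right single_add simp flip: sum.distrib
        intro!: sum.cong)
qed

lemma trace_times_add_right:
  "trace_times X dX i x (y + y') = trace_times X dX i x y + trace_times X dX i x y'"
proof -
  have "finite (Poly_Mapping.keys y \<union> Poly_Mapping.keys y')"
    by simp
  note * = trace_times_superset[OF finite_keys order_refl this]
  show ?thesis
    by (auto simp: * keys_add lookup_add distrib_left single_add simp flip: sum.distrib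
        intro!: sum.cong)
qed

lemma trace_times_single:
  "trace_times X dX i (Poly_Mapping.single P a) (Poly_Mapping.single Q b) =
     (if composable X dX i P Q then Poly_Mapping.single (trace_concat X dX i P Q) (a * b) else 0)"
  by (subst trace_times_superset[of "{P}" _ "{Q}"]) auto

lemma trace_times_sum:
  "trace_times X dX i (sum f I) (sum g J) =
     (\<Sum>P\<in>I. \<Sum>Q\<in>J. trace_times X dX i (f P) (g Q))"
proof -
  have "trace_times X dX i x (sum g J) = (\<Sum>Q\<in>J. trace_times X dX i x (g Q))" for x
    using sum_comp_morphism[of "trace_times X dX i x" g J]
    by (simp add: trace_times_zero trace_times_add_right o_def)
  moreover have "trace_times X dX i (sum f I) y = (\<Sum>P\<in>I. trace_times X dX i (f P) y)" for y
    using sum_comp_morphism[of "\<lambda>x. trace_times X dX i x y" f I]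
    by (simp add: trace_times_zero trace_times_add_left o_def)
  ultimately show ?thesis
    by (simp add: sum.swap[of _ J])
qed

lemma keys_trace_times:
  "Poly_Mapping.keys (trace_times X dX i x y) \<subseteq>
     {trace_concat X dX i P Q | P Q.
        P \<in> Poly_Mapping.keys x \<and> Q \<in> Poly_Mapping.keys y \<and> composable X dX i P Q}"
  unfolding trace_times_def
  by (fastforce dest!: subsetD[OF keys_sum] split: if_splits)

text \<open>Bilinearity reduces the claim to basis elements. Composability must be reflected as well
  as preserved, since products that vanish have to stay zero.\<close>

lemma pushforward_trace_times:
  assumes "\<And>P Q. \<lbrakk>P \<in> Poly_Mapping.keys x; Q \<in> Poly_Mapping.keys y\<rbrakk>
      \<Longrightarrow> composable X dX j (f P) (f Q) \<longleftrightarrow> composable X dX i P Q"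
    and "\<And>P Q. \<lbrakk>P \<in> Poly_Mapping.keys x; Q \<in> Poly_Mapping.keys y; composable X dX i P Q\<rbrakk>
      \<Longrightarrow> f (trace_concat X dX i P Q) = trace_concat X dX j (f P) (f Q)"
  shows "pushforward f (trace_times X dX i x y) =
    trace_times X dX j (pushforward f x) (pushforward f y)"
  unfolding pushforward_def[of f x] pushforward_def[of f y] trace_times_def[of X dX i]
  using assms
  by (auto simp: pushforward_sum trace_times_sum trace_times_single pushforward_single
      pushforward_zero intro!: sum.cong)


section \<open>Maps of simplices\<close>

text \<open>Points of a simplex are sequences indexed by all naturals that vanish beyond its
  dimension. One formula therefore serves in every dimension, as with
  \<open>simplical_face\<close>.\<close>

definition simplex_degen :: "nat \<Rightarrow> (nat \<Rightarrow> 'c) \<Rightarrow> nat \<Rightarrow> 'c::comm_monoid_add" where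
  "simplex_degen k t = (\<lambda>i. if i < k then t i else if i = k then t k + t (Suc k) else t (Suc i))"

abbreviation simplex_top :: "nat \<Rightarrow> (nat \<Rightarrow> real) topology" where
  "simplex_top n \<equiv> subtopology (powertop_real UNIV) (standard_simplex n)"

abbreviation ipath_top :: "nat \<Rightarrow> (real \<times> (nat \<Rightarrow> real)) topology" where
  "ipath_top i \<equiv> prod_topology (subtopology euclideanreal {0..1}) (simplex_top (i - 1))"

lemma topspace_ipath_top: "topspace (ipath_top i) = ipath_dom i"
  by (simp add: ipath_dom_def)

lemma sum_simplex_degen:
  "k \<le> n \<Longrightarrow> (\<Sum>i\<le>n. simplex_degen k t i) = (\<Sum>i\<le>Suc n. t i)"
proof (induction n)
  case (Suc n)
  show ?case
  \<comment> \<open>If the merged entry is the last one, all earlier entries are unchanged.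
    Otherwise the last entry is a shifted one and the induction hypothesis covers the rest.\<close>
  proof (cases "k = Suc n")
    case True
    have "(\<Sum>i\<le>n. simplex_degen k t i) = (\<Sum>i\<le>n. t i)"
      using True by (intro sum.cong) (auto simp: simplex_degen_def)
    then show ?thesis
      using True by (simp add: simplex_degen_def add.assoc)
  next
    case False
    with Suc show ?thesis
      by (simp add: simplex_degen_def)
  qed
qed (simp add: simplex_degen_def)

lemma simplex_degen_in_standard_simplex:
  assumes "k \<le> n" "t \<in> standard_simplex (Suc n)"
  shows "simplex_degen k t \<in> standard_simplex n"
proof -
  have nonneg: "0 \<le> simplex_degen k t i" and vanish: "n < i \<Longrightarrow> simplex_degen k t i = 0" for i
    using assms by (auto simp: standard_simplex_def simplex_degen_def)
  have sum: "(\<Sum>i\<le>n. simplex_degen k t i) = 1"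
    using assms by (simp add: sum_simplex_degen standard_simplex_def)
  \<comment> \<open>\<open>standard_simplex\<close> also demands this bound; one entry cannot exceed
    the total of non-negative entries.\<close>
  have "simplex_degen k t i \<le> 1" for i
  proof (cases "i \<le> n")
    case True
    then show ?thesis
      using member_le_sum[of i "{..n}" "simplex_degen k t"] nonneg sum by simp
  qed (simp add: vanish)
  then show ?thesis
    using nonneg vanish sum by (simp add: standard_simplex_def)
qed

lemma continuous_map_simplex_degen:
  assumes "k \<le> n"
  shows "continuous_map (simplex_top (Suc n)) (simplex_top n) (simplex_degen k)"
  using assms
  by (auto simp: continuous_map_in_subtopology continuous_map_componentwise_UNIV
      simplex_degen_in_standard_simplex simplex_degen_def[abs_def]
      intro!: continuous_intros simplex_degen_in_standard_simplex[unfolded simplex_degen_def])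

lemma continuous_map_simplical_face:
  assumes "j \<le> Suc n"
  shows "continuous_map (simplex_top n) (simplex_top (Suc n)) (simplical_face j)"
  using assms simplical_face_in_standard_simplex[of "Suc n" j]
  by (auto simp: continuous_map_in_subtopology continuous_map_componentwise_UNIV
      simplical_face_def[abs_def] intro!: continuous_intros)

text \<open>This and the next three are the cosimplicial identities, checked coordinatewise on
  arbitrary sequences. Pulling back reverses the order of composition and turns them into the
  simplicial identities of \<open>face_degeneracy_algebra\<close>.\<close>

lemma simplex_degen_face_less:
  "j < k \<Longrightarrow> simplex_degen k (simplical_face j t) = simplical_face j (simplex_degen (k - 1) t)"
  by (auto simp: simplex_degen_def simplical_face_def fun_eq_iff)

lemma simplex_degen_face_same: "simplex_degen k (simplical_face k t) = t"
  by (auto simp: simplex_degen_def simplical_face_def fun_eq_iff)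

lemma simplex_degen_face_Suc: "simplex_degen k (simplical_face (Suc k) t) = t"
  by (auto simp: simplex_degen_def simplical_face_def fun_eq_iff)

lemma simplex_degen_face_greater:
  "Suc k < j \<Longrightarrow> simplex_degen k (simplical_face j t) = simplical_face (j - 1) (simplex_degen k t)"
  by (auto simp: simplex_degen_def simplical_face_def fun_eq_iff)


section \<open>Pullback of traces\<close>

definition ipath_pull :: "nat \<Rightarrow> ((nat \<Rightarrow> real) \<Rightarrow> (nat \<Rightarrow> real)) \<Rightarrow> 'a ipath \<Rightarrow> 'a ipath" where
  "ipath_pull i \<alpha> p = (\<lambda>(s, t)\<in>ipath_dom i. p (s, \<alpha> t))"

definition trace_pull ::
  "'a topology \<Rightarrow> (real \<Rightarrow> 'a) set \<Rightarrow> nat \<Rightarrow> ((nat \<Rightarrow> real) \<Rightarrow> (nat \<Rightarrow> real)) \<Rightarrow> 'a trace \<Rightarrow> 'a trace"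
  where "trace_pull X dX i \<alpha> P = (\<Union>p\<in>P. trace_rel X dX i `` {ipath_pull i \<alpha> p})"

lemma trace_face_eq: "trace_face X dX i j = trace_pull X dX i (simplical_face j)"
  by (simp add: fun_eq_iff trace_face_def trace_pull_def ipath_face_def ipath_pull_def)

section \<open>Trace classes and their end points\<close>

lemma equiv_trace_rel: "equiv (ipaths X dX i) (trace_rel X dX i)"
  by (auto simp: equiv_def refl_on_def sym_def trans_def trace_rel_def
      intro: equivclp_sym equivclp_trans)

lemma trace_rel_class_eq:
  "(p, q) \<in> trace_rel X dX i \<Longrightarrow> trace_rel X dX i `` {p} = trace_rel X dX i `` {q}"
  by (rule equiv_class_eq[OF equiv_trace_rel])

lemma trace_rel_class_self:
  "p \<in> ipaths X dX i \<Longrightarrow> p \<in> trace_rel X dX i `` {p}"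
  by (simp add: trace_rel_def)

text \<open>The values 0 and 1 are attained somewhere, and monotonicity forces them at the ends of
  the interval.\<close>

lemma mono_onto_unit_interval:
  fixes \<phi> :: "real \<Rightarrow> real"
  assumes mono: "mono_on {0..1} \<phi>" and onto: "\<phi> ` {0..1} = {0..1}"
  shows "\<phi> 0 = 0" "\<phi> 1 = 1" "s \<in> {0..1} \<Longrightarrow> \<phi> s \<in> {0..1}"
proof -
  show range: "\<phi> s \<in> {0..1}" if "s \<in> {0..1}" for s
    using onto that by blast
  have "0 \<in> \<phi> ` {0..1}" "1 \<in> \<phi> ` {0..1}"
    by (simp_all add: onto)
  then obtain u v where uv: "u \<in> {0..1}" "v \<in> {0..1}" "\<phi> u = 0" "\<phi> v = 1"
    by fastforce
  show "\<phi> 0 = 0"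
    using mono_onD[OF mono, of 0 u] range[of 0] uv by auto
  show "\<phi> 1 = 1"
    using mono_onD[OF mono, of v 1] range[of 1] uv by auto
qed

text \<open>A reparametrization fixes 0 and 1. An equivalence is proved because the trace relation
  is generated by steps in both directions.\<close>

lemma reparametrizes_between:
  assumes "reparametrizes X dX i p q"
  shows "p \<in> ipaths_between X dX i a b \<longleftrightarrow> q \<in> ipaths_between X dX i a b"
proof -
  from assms obtain \<phi> where \<phi>: "mono_on {0..1} \<phi>" "\<phi> ` {0..1} = {0..1}"
    and q: "q = (\<lambda>(s, t)\<in>ipath_dom i. p (\<phi> s, t))"
    and mem: "p \<in> ipaths X dX i" "q \<in> ipaths X dX i"
    by (auto simp: reparametrizes_def)
  then show ?thesis
    using mono_onto_unit_interval(1,2)[OF \<phi>] mem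
    by (auto simp: ipaths_between_def q ipath_dom_def)
qed

lemma trace_rel_between:
  assumes "(p, q) \<in> trace_rel X dX i" "p \<in> ipaths_between X dX i a b"
  shows "q \<in> ipaths_between X dX i a b"
proof -
  from assms(1) have "equivclp (reparametrizes X dX i) p q"
    by (simp add: trace_rel_def)
  then show ?thesis
  proof induction
    case (step y z)
    then show ?case
      using reparametrizes_between[of X dX i y z a b] reparametrizes_between[of X dX i z y a b]
      by blast
  qed (rule assms(2))
qed

lemma traces_betweenI:
  "p \<in> ipaths_between X dX i a b \<Longrightarrow> trace_rel X dX i `` {p} \<in> traces_between X dX i a b"
  by (simp add: traces_between_def quotientI)

lemma traces_betweenE:
  assumes "P \<in> traces_between X dX i a b"
  obtains p where "p \<in> ipaths_between X dX i a b" "P = trace_rel X dX i `` {p}"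
  using assms by (auto simp: traces_between_def quotient_def)

text \<open>End points are constant along a trace class, and the simplex has a point at which they
  can be read off.\<close>

lemma traces_between_unique:
  assumes "P \<in> traces_between X dX i a b" "P \<in> traces_between X dX i c e"
  shows "a = c" "b = e"
proof -
  obtain p where p: "p \<in> ipaths_between X dX i a b" "P = trace_rel X dX i `` {p}"
    using assms(1) by (rule traces_betweenE)
  obtain q where q: "q \<in> ipaths_between X dX i c e" "P = trace_rel X dX i `` {q}"
    using assms(2) by (rule traces_betweenE)
  have "(q, p) \<in> trace_rel X dX i"
    using trace_rel_class_self[of p X dX i] p q by (auto simp: ipaths_between_def)
  from trace_rel_between[OF this q(1)] have "p \<in> ipaths_between X dX i c e" .
  with p(1) nonempty_standard_simplex[of "i - 1"] show "a = c" "b = e"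
    by (auto simp: ipaths_between_def)
qed

text \<open>Uniqueness of end points replaces the existential in \<open>composable\<close> by a
  comparison of known points, which pullback leaves unchanged.\<close>

lemma composable_iff:
  assumes "P \<in> traces_between X dX i a b" "Q \<in> traces_between X dX i c e"
    and "a \<in> topspace X" "b \<in> topspace X" "e \<in> topspace X"
  shows "composable X dX i P Q \<longleftrightarrow> b = c"
  using assms traces_between_unique[OF assms(1)] traces_between_unique[OF assms(2)]
  unfolding composable_def by metis

section \<open>Pullback along a continuous map of simplices\<close>

context
  fixes \<alpha> :: "(nat \<Rightarrow> real) \<Rightarrow> (nat \<Rightarrow> real)" and i j :: nat
  assumes \<alpha>: "continuous_map (simplex_top (i - 1)) (simplex_top (j - 1)) \<alpha>"
begin

lemma simplex_map_in: "t \<in> standard_simplex (i - 1) \<Longrightarrow> \<alpha> t \<in> standard_simplex (j - 1)"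
  using continuous_map_funspace[OF \<alpha>] by auto

lemma ipath_pull_in_ipaths:
  assumes p: "p \<in> ipaths X dX j"
  shows "ipath_pull i \<alpha> p \<in> ipaths X dX i"
proof -
  have "continuous_map (ipath_top i) (ipath_top j) (\<lambda>z. (fst z, \<alpha> (snd z)))"
    by (intro continuous_map_pairedI continuous_map_fst
        continuous_map_compose[OF continuous_map_snd \<alpha>, unfolded o_def])
  moreover have "continuous_map (ipath_top j) X p"
    using p by (simp add: ipaths_def)
  ultimately have "continuous_map (ipath_top i) X (p \<circ> (\<lambda>z. (fst z, \<alpha> (snd z))))"
    by (rule continuous_map_compose)
  then have "continuous_map (ipath_top i) X (ipath_pull i \<alpha> p)"
    by (rule continuous_map_eq) (auto simp: ipath_pull_def ipath_dom_def)
  moreover have "(\<lambda>s. ipath_pull i \<alpha> p (s, t)) \<in> dX" if t: "t \<in> standard_simplex (i - 1)" for t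
  proof -
    \<comment> \<open>Off the unit interval both sides are \<open>undefined\<close>, the right one
      because \<open>p\<close> is extensional.\<close>
    have "(\<lambda>s. ipath_pull i \<alpha> p (s, t)) = (\<lambda>s. p (s, \<alpha> t))"
      using p t by (auto simp: ipath_pull_def ipath_dom_def fun_eq_iff ipaths_def extensional_def)
    then show ?thesis
      using p simplex_map_in[OF t] by (simp add: ipaths_def)
  qed
  ultimately show ?thesis
    by (simp add: ipaths_def ipath_pull_def)
qed

lemma ipath_pull_between:
  assumes p: "p \<in> ipaths_between X dX j a b"
  shows "ipath_pull i \<alpha> p \<in> ipaths_between X dX i a b"
  using p simplex_map_in
  by (auto simp: ipaths_between_def ipath_pull_in_ipaths) (auto simp: ipath_pull_def ipath_dom_def)

text \<open>The same \<open>\<phi>\<close> works: it acts on the time coordinate and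
  \<open>\<alpha>\<close> on the simplex coordinate.\<close>

lemma reparametrizes_pull:
  assumes "reparametrizes X dX j p q"
  shows "reparametrizes X dX i (ipath_pull i \<alpha> p) (ipath_pull i \<alpha> q)"
proof -
  from assms obtain \<phi> where \<phi>: "continuous_on {0..1} \<phi>" "mono_on {0..1} \<phi>" "\<phi> ` {0..1} = {0..1}"
    and q: "q = (\<lambda>(s, t)\<in>ipath_dom j. p (\<phi> s, t))"
    and mem: "p \<in> ipaths X dX j" "q \<in> ipaths X dX j"
    by (auto simp: reparametrizes_def)
  have "\<phi> s \<in> {0..1}" if "s \<in> {0..1}" for s
    using \<phi>(3) that by blast
  then have "ipath_pull i \<alpha> q = (\<lambda>(s, t)\<in>ipath_dom i. ipath_pull i \<alpha> p (\<phi> s, t))"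
    using simplex_map_in by (auto simp: ipath_pull_def ipath_dom_def q fun_eq_iff restrict_def)
  then show ?thesis
    unfolding reparametrizes_def
    using \<phi> ipath_pull_in_ipaths[OF mem(1)] ipath_pull_in_ipaths[OF mem(2)] by blast
qed

lemma trace_rel_pull:
  assumes "(p, q) \<in> trace_rel X dX j"
  shows "(ipath_pull i \<alpha> p, ipath_pull i \<alpha> q) \<in> trace_rel X dX i"
proof -
  from assms have "equivclp (reparametrizes X dX j) p q"
    by (simp add: trace_rel_def)
  then have "equivclp (reparametrizes X dX i) (ipath_pull i \<alpha> p) (ipath_pull i \<alpha> q)"
  proof induction
    case (step q r)
    then show ?case
      by (meson reparametrizes_pull equivclp_trans r_into_equivclp converse_r_into_equivclp)
  qed simp
  with assms show ?thesis
    by (simp add: trace_rel_def ipath_pull_in_ipaths)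
qed

text \<open>All representatives contribute the same class, so the union in \<open>trace_pull\<close>
  is computed by any one of them.\<close>

lemma trace_pull_class:
  assumes "p \<in> ipaths X dX j"
  shows "trace_pull X dX i \<alpha> (trace_rel X dX j `` {p}) = trace_rel X dX i `` {ipath_pull i \<alpha> p}"
proof -
  have "trace_rel X dX i `` {ipath_pull i \<alpha> q} = trace_rel X dX i `` {ipath_pull i \<alpha> p}"
    if "q \<in> trace_rel X dX j `` {p}" for q
    using that trace_rel_pull trace_rel_class_eq by blast
  then show ?thesis
    using trace_rel_class_self[OF assms] unfolding trace_pull_def by blast
qed

lemma trace_pull_between:
  assumes "P \<in> traces_between X dX j a b"
  shows "trace_pull X dX i \<alpha> P \<in> traces_between X dX i a b"
proof -
  obtain p where p: "p \<in> ipaths_between X dX j a b" "P = trace_rel X dX j `` {p}"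
    using assms by (rule traces_betweenE)
  then have "p \<in> ipaths X dX j"
    by (simp add: ipaths_between_def)
  then show ?thesis
    by (simp add: p(2) trace_pull_class traces_betweenI ipath_pull_between[OF p(1)])
qed

lemma trace_pull_in_traces:
  assumes "P \<in> traces X dX j"
  shows "trace_pull X dX i \<alpha> P \<in> traces X dX i"
proof -
  obtain a b where "a \<in> topspace X" "b \<in> topspace X" "P \<in> traces_between X dX j a b"
    using assms by (auto simp: traces_def)
  then show ?thesis
    unfolding traces_def by (intro UN_I[of a] UN_I[of b] trace_pull_between)
qed

text \<open>Pullback keeps both end points, and these decide composability, so composable pairs are
  neither created nor lost.\<close>

lemma composable_pull:
  assumes "P \<in> traces X dX j" "Q \<in> traces X dX j"
  shows "composable X dX i (trace_pull X dX i \<alpha> P) (trace_pull X dX i \<alpha> Q) \<longleftrightarrow>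
    composable X dX j P Q"
proof -
  obtain a b c e where "a \<in> topspace X" "b \<in> topspace X" "e \<in> topspace X"
    and "P \<in> traces_between X dX j a b" "Q \<in> traces_between X dX j c e"
    using assms by (auto simp: traces_def)
  then show ?thesis
    by (simp add: composable_iff[where a = a and b = b and c = c and e = e] trace_pull_between)
qed

lemma pushforward_trace_pull_closed:
  "x \<in> trace_module X dX j \<Longrightarrow> pushforward (trace_pull X dX i \<alpha>) x \<in> trace_module X dX i"
  using keys_pushforward[of "trace_pull X dX i \<alpha>" x] trace_pull_in_traces
  by (fastforce simp: trace_module_def)

end

section \<open>Functoriality of pullback\<close>

lemma trace_pull_compose:
  assumes \<alpha>: "continuous_map (simplex_top (i - 1)) (simplex_top (j - 1)) \<alpha>"
    and \<beta>: "continuous_map (simplex_top (j - 1)) (simplex_top (k - 1)) \<beta>"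
    and P: "P \<in> traces X dX k"
  shows "trace_pull X dX i \<alpha> (trace_pull X dX j \<beta> P) = trace_pull X dX i (\<beta> \<circ> \<alpha>) P"
proof -
  obtain p where p: "p \<in> ipaths X dX k" "P = trace_rel X dX k `` {p}"
    using P by (auto simp: traces_def ipaths_between_def elim!: traces_betweenE)
  \<comment> \<open>\<open>\<alpha>\<close> maps into the middle simplex, so the inner restriction
    is evaluated only inside its domain.\<close>
  have "ipath_pull i \<alpha> (ipath_pull j \<beta> p) = ipath_pull i (\<beta> \<circ> \<alpha>) p"
    using simplex_map_in[OF \<alpha>] by (auto simp: ipath_pull_def ipath_dom_def fun_eq_iff restrict_def)
  then show ?thesis
    using p continuous_map_compose[OF \<alpha> \<beta>]
    by (simp add: trace_pull_class[OF \<alpha>] trace_pull_class[OF \<beta>] trace_pull_class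
        ipath_pull_in_ipaths[OF \<beta>])
qed

lemma trace_pull_ident:
  assumes "P \<in> traces X dX i"
  shows "trace_pull X dX i (\<lambda>t. t) P = P"
proof -
  obtain p where p: "p \<in> ipaths X dX i" "P = trace_rel X dX i `` {p}"
    using assms by (auto simp: traces_def ipaths_between_def elim!: traces_betweenE)
  have "ipath_pull i (\<lambda>t. t) p = p"
    using p by (auto simp: ipath_pull_def fun_eq_iff restrict_def ipaths_def extensional_def)
  then show ?thesis
    using p trace_pull_class[of i i "\<lambda>t. t" p X dX] by simp
qed

lemma pushforward_trace_pull_compose:
  assumes "continuous_map (simplex_top (i - 1)) (simplex_top (j - 1)) \<alpha>"
    and "continuous_map (simplex_top (j - 1)) (simplex_top (k - 1)) \<beta>"
    and "x \<in> trace_module X dX k"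
  shows "pushforward (trace_pull X dX i \<alpha>) (pushforward (trace_pull X dX j \<beta>) x) =
    pushforward (trace_pull X dX i (\<beta> \<circ> \<alpha>)) x"
  unfolding pushforward_pushforward
  using assms by (intro pushforward_cong) (auto simp: trace_pull_compose trace_module_def)

lemma pushforward_trace_pull_ident:
  assumes "x \<in> trace_module X dX i"
  shows "pushforward (trace_pull X dX i (\<lambda>t. t)) x = x"
proof -
  have "pushforward (trace_pull X dX i (\<lambda>t. t)) x = pushforward (\<lambda>P. P) x"
    using assms by (intro pushforward_cong) (auto simp: trace_pull_ident trace_module_def)
  then show ?thesis
    by (simp flip: poly_mapping_expand)
qed


section \<open>Concatenation of traces\<close>

lemma ipath_concat_between:
  assumes dsp: "d_space X dX"
    and p: "p \<in> ipaths_between X dX i a b" and q: "q \<in> ipaths_between X dX i b c"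
  shows "ipath_concat i p q \<in> ipaths_between X dX i a c"
proof -
  have cont: "continuous_map (ipath_top i) X p" "continuous_map (ipath_top i) X q"
    using p q by (auto simp: ipaths_between_def ipaths_def)
  have fst: "continuous_map (ipath_top i) euclideanreal fst"
    using continuous_map_fst continuous_map_in_subtopology by blast
  \<comment> \<open>Both halves are covered: \<open>v = 0\<close> gives the time change on the first
    half and \<open>v = 1\<close> the one on the second.\<close>
  have rescale: "continuous_map (subtopology (ipath_top i) S) (ipath_top i)
      (\<lambda>z. (2 * fst z - v, snd z))"
    if "\<And>z. z \<in> ipath_dom i \<inter> S \<Longrightarrow> 2 * fst z - v \<in> {0..1}" for S v
  proof (rule continuous_map_pairedI)
    have "continuous_map (subtopology (ipath_top i) S) euclideanreal (\<lambda>z. 2 * fst z - v)"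
      by (intro continuous_map_diff continuous_map_real_mult continuous_map_const[THEN iffD2]
          continuous_map_from_subtopology fst) auto
    moreover have "topspace (subtopology (ipath_top i) S) = ipath_dom i \<inter> S"
      by (simp only: topspace_subtopology topspace_ipath_top)
    ultimately show "continuous_map (subtopology (ipath_top i) S) (subtopology euclideanreal {0..1})
        (\<lambda>z. 2 * fst z - v)"
      using that by (auto simp only: continuous_map_in_subtopology)
  qed (rule continuous_map_from_subtopology[OF continuous_map_snd])
  \<comment> \<open>The two closed halves can be pasted because at time 1/2 both formulas give
    \<open>b\<close>, the end of \<open>p\<close> and the start of \<open>q\<close>.\<close>
  have join: "continuous_map (ipath_top i) X
    (\<lambda>z. if fst z \<le> 1/2 then p (2 * fst z, snd z) else q (2 * fst z - 1, snd z))"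
  proof (rule continuous_map_cases_le)
    show "continuous_map (subtopology (ipath_top i) {z \<in> topspace (ipath_top i). fst z \<le> 1/2}) X
        (\<lambda>z. p (2 * fst z, snd z))"
      using continuous_map_compose[OF rescale[of "{z \<in> topspace (ipath_top i). fst z \<le> 1/2}" 0] cont(1)]
      by (auto simp: o_def ipath_dom_def)
    show "continuous_map (subtopology (ipath_top i) {z \<in> topspace (ipath_top i). 1/2 \<le> fst z}) X
        (\<lambda>z. q (2 * fst z - 1, snd z))"
      using continuous_map_compose[OF rescale[of "{z \<in> topspace (ipath_top i). 1/2 \<le> fst z}" 1] cont(2)]
      by (auto simp: o_def ipath_dom_def)
  qed (use p q fst in \<open>auto simp: ipaths_between_def mult.commute[of 2]\<close>)
  have "continuous_map (ipath_top i) X (ipath_concat i p q)"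
    by (rule continuous_map_eq[OF join]) (auto simp: ipath_concat_def ipath_dom_def)
  moreover have "(\<lambda>s. ipath_concat i p q (s, t)) \<in> dX" if t: "t \<in> standard_simplex (i - 1)" for t
  proof -
    have "(\<lambda>s. ipath_concat i p q (s, t)) = concat_path (\<lambda>s. p (s, t)) (\<lambda>s. q (s, t))"
      using t by (auto simp: ipath_concat_def concat_path_def ipath_dom_def fun_eq_iff restrict_def)
    then show ?thesis
      using dsp p q t by (simp add: d_space_def ipaths_between_def ipaths_def)
  qed
  ultimately have "ipath_concat i p q \<in> ipaths X dX i"
    by (simp add: ipaths_def ipath_concat_def)
  then show ?thesis
    using p q by (auto simp: ipaths_between_def ipath_concat_def ipath_dom_def)
qed

text \<open>Rescaled copies of \<open>\<phi>\<close> and \<open>\<theta>\<close> are placed on the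
  two halves of the interval. Since both fix 0 and 1, the copies meet at 1/2 and form an admissible
  reparametrization \<open>\<psi>\<close>.\<close>

lemma reparametrizes_concat:
  assumes dsp: "d_space X dX"
    and pp': "reparametrizes X dX i p p'" and qq': "reparametrizes X dX i q q'"
    and p: "p \<in> ipaths_between X dX i a b" and q: "q \<in> ipaths_between X dX i b c"
  shows "reparametrizes X dX i (ipath_concat i p q) (ipath_concat i p' q')"
proof -
  obtain \<phi> where \<phi>: "continuous_on {0..1} \<phi>" "mono_on {0..1} \<phi>" "\<phi> ` {0..1} = {0..1}"
    and p': "p' = (\<lambda>(s, t)\<in>ipath_dom i. p (\<phi> s, t))"
    using pp' by (auto simp: reparametrizes_def)
  obtain \<theta> where \<theta>: "continuous_on {0..1} \<theta>" "mono_on {0..1} \<theta>" "\<theta> ` {0..1} = {0..1}"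
    and q': "q' = (\<lambda>(s, t)\<in>ipath_dom i. q (\<theta> s, t))"
    using qq' by (auto simp: reparametrizes_def)
  note \<phi>_unit = mono_onto_unit_interval[OF \<phi>(2,3)]
  note \<theta>_unit = mono_onto_unit_interval[OF \<theta>(2,3)]
  define \<psi> where "\<psi> s = (if s \<le> 1/2 then \<phi> (2 * s) / 2 else (1 + \<theta> (2 * s - 1)) / 2)" for s
  have "continuous_on {0..1} \<psi>"
    unfolding \<psi>_def
  proof (rule continuous_on_cases_le)
    show "continuous_on {t \<in> {0..1}. t \<le> 1/2} (\<lambda>s. \<phi> (2 * s) / 2)"
      by (intro continuous_intros continuous_on_compose2[OF \<phi>(1)]) auto
    show "continuous_on {t \<in> {0..1}. 1/2 \<le> t} (\<lambda>s. (1 + \<theta> (2 * s - 1)) / 2)"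
      by (intro continuous_intros continuous_on_compose2[OF \<theta>(1)]) auto
  qed (auto simp: \<phi>_unit \<theta>_unit mult.commute[of 2])
  moreover have low: "0 \<le> \<psi> s" "\<psi> s \<le> 1/2" if "0 \<le> s" "s \<le> 1/2" for s
    using that \<phi>_unit(3)[of "2 * s"] by (auto simp: \<psi>_def)
  moreover have high: "1/2 \<le> \<psi> s" "\<psi> s \<le> 1" if "1/2 < s" "s \<le> 1" for s
    using that \<theta>_unit(3)[of "2 * s - 1"] by (auto simp: \<psi>_def)
  moreover have "mono_on {0..1} \<psi>"
  proof (rule mono_onI)
    fix r s :: real
    assume rs: "r \<in> {0..1}" "s \<in> {0..1}" "r \<le> s"
    consider "s \<le> 1/2" | "r \<le> 1/2" "1/2 < s" | "1/2 < r"
      by linarith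
    then show "\<psi> r \<le> \<psi> s"
    proof cases
      case 1
      then show ?thesis
        using rs mono_onD[OF \<phi>(2), of "2 * r" "2 * s"] by (simp add: \<psi>_def)
    next
      case 2
      then show ?thesis
        using rs low(2)[of r] high(1)[of s] by simp
    next
      case 3
      then show ?thesis
        using rs mono_onD[OF \<theta>(2), of "2 * r - 1" "2 * s - 1"] by (simp add: \<psi>_def)
    qed
  qed
  moreover have "\<psi> ` {0..1} = {0..1}"
  proof (intro equalityI subsetI)
    fix y :: real
    assume "y \<in> \<psi> ` {0..1}"
    then obtain s where "s \<in> {0..1}" "y = \<psi> s"
      by blast
    then show "y \<in> {0..1}"
      using low[of s] high[of s] by (cases "s \<le> 1/2") auto
  next
    fix y :: real
    assume y: "y \<in> {0..1}"
    show "y \<in> \<psi> ` {0..1}"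
    proof (cases "y \<le> 1/2")
      case True
      then have "2 * y \<in> \<phi> ` {0..1}"
        using y by (simp add: \<phi>(3))
      then obtain u where "u \<in> {0..1}" "2 * y = \<phi> u"
        by blast
      then show ?thesis
        by (intro image_eqI[of _ _ "u / 2"]) (auto simp: \<psi>_def)
    next
      case False
      then have "2 * y - 1 \<in> \<theta> ` {0..1}"
        using y by (simp add: \<theta>(3))
      then obtain u where u: "u \<in> {0..1}" "2 * y - 1 = \<theta> u"
        by blast
      \<comment> \<open>At 1/2 the definition of \<open>\<psi>\<close> takes its first branch.
        Excluding \<open>u = 0\<close> keeps \<open>(1 + u) / 2\<close> in the second
        branch.\<close>
      then have "u \<noteq> 0"
        using False \<theta>_unit(1) by auto
      then have "\<psi> ((1 + u) / 2) = (1 + \<theta> (2 * ((1 + u) / 2) - 1)) / 2"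
        using u unfolding \<psi>_def by auto
      moreover have "2 * ((1 + u) / 2) - 1 = u"
        by (simp add: field_simps)
      ultimately have "\<psi> ((1 + u) / 2) = y"
        using u(2) by simp
      then show ?thesis
        using u(1) by (intro image_eqI[of _ _ "(1 + u) / 2"]) auto
    qed
  qed
  moreover have "ipath_concat i p' q' =
    (\<lambda>(s, t)\<in>ipath_dom i. ipath_concat i p q (\<psi> s, t))"
  proof (rule ext, clarify)
    fix s t
    consider "(s, t) \<notin> ipath_dom i"
      | "0 \<le> s" "s \<le> 1/2" "t \<in> standard_simplex (i - 1)"
      | "1/2 < s" "s \<le> 1" "t \<in> standard_simplex (i - 1)"
      by (cases "s \<le> 1/2"; cases "(s, t) \<in> ipath_dom i") (auto simp: ipath_dom_def)
    then show "ipath_concat i p' q' (s, t) =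
        (\<lambda>(s, t)\<in>ipath_dom i. ipath_concat i p q (\<psi> s, t)) (s, t)"
    proof cases
      case 1
      then show ?thesis
        by (simp add: ipath_concat_def)
    next
      case 2
      then show ?thesis
        using low[of s] by (simp add: ipath_concat_def ipath_dom_def p' \<psi>_def)
    next
      case 3
      \<comment> \<open>\<open>\<psi> s\<close> may equal 1/2, namely where \<open>\<theta>\<close>
        is still 0. The concatenation then reads \<open>p\<close> at its end, which is
        \<open>b\<close>, the start of \<open>q\<close>.\<close>
      then have "ipath_concat i p q (\<psi> s, t) = q (2 * \<psi> s - 1, t)"
        using high[of s] p q by (auto simp: ipath_concat_def ipath_dom_def ipaths_between_def mult.commute[of 2])
      moreover have "2 * \<psi> s - 1 = \<theta> (2 * s - 1)"
        using 3 by (simp add: \<psi>_def field_simps)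
      ultimately show ?thesis
        using 3 high[of s] by (simp add: ipath_concat_def[of _ p'] ipath_dom_def q')
    qed
  qed
  moreover have "ipath_concat i p q \<in> ipaths X dX i"
    using ipath_concat_between[OF dsp p q] by (simp add: ipaths_between_def)
  moreover have "ipath_concat i p' q' \<in> ipaths X dX i"
    using ipath_concat_between[OF dsp p[unfolded reparametrizes_between[OF pp']]
        q[unfolded reparametrizes_between[OF qq']]]
    by (simp add: ipaths_between_def)
  ultimately show ?thesis
    unfolding reparametrizes_def by blast
qed

lemma reparametrizes_refl:
  assumes "p \<in> ipaths X dX i"
  shows "reparametrizes X dX i p p"
  unfolding reparametrizes_def
proof (intro conjI exI[of _ "\<lambda>s. s"] assms)
  show "p = (\<lambda>(s, t)\<in>ipath_dom i. p (s, t))"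
    using assms by (auto simp: ipaths_def extensional_def fun_eq_iff restrict_def)
qed (auto intro: mono_onI)

text \<open>The zigzags from \<open>p\<close> to \<open>p'\<close> and from \<open>q\<close> to
  \<open>q'\<close> may differ in length and direction, so they are run one after the other: first
  with \<open>q\<close> held fixed, then with \<open>p'\<close> held fixed.\<close>

lemma trace_rel_concat:
  assumes dsp: "d_space X dX"
    and pp': "(p, p') \<in> trace_rel X dX i" and qq': "(q, q') \<in> trace_rel X dX i"
    and p: "p \<in> ipaths_between X dX i a b" and q: "q \<in> ipaths_between X dX i b c"
  shows "(ipath_concat i p q, ipath_concat i p' q') \<in> trace_rel X dX i"
proof -
  let ?R = "reparametrizes X dX i"
  have p': "p' \<in> ipaths_between X dX i a b" and q': "q' \<in> ipaths_between X dX i b c"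
    using trace_rel_between[OF pp' p] trace_rel_between[OF qq' q] .
  have refl: "?R p' p'" "?R q q"
    using p' q by (auto simp: ipaths_between_def intro: reparametrizes_refl)
  have "equivclp ?R p p'" "equivclp ?R q q'"
    using pp' qq' by (auto simp: trace_rel_def)
  \<comment> \<open>The end points are carried through the induction because every intermediate path
    must remain composable with \<open>q\<close>.\<close>
  from this(1) have "p' \<in> ipaths_between X dX i a b \<and>
    equivclp ?R (ipath_concat i p q) (ipath_concat i p' q)"
  proof induction
    case (step y z)
    then have yz: "y \<in> ipaths_between X dX i a b" "z \<in> ipaths_between X dX i a b"
      using reparametrizes_between[of X dX i y z a b] reparametrizes_between[of X dX i z y a b]
      by blast+
    have "?R (ipath_concat i y q) (ipath_concat i z q) \<or>
      ?R (ipath_concat i z q) (ipath_concat i y q)"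
      using step.hyps(2) reparametrizes_concat[OF dsp _ refl(2) yz(1) q]
        reparametrizes_concat[OF dsp _ refl(2) yz(2) q] by blast
    then show ?case
      using step.IH yz(2) by (meson equivclp_trans r_into_equivclp converse_r_into_equivclp)
  qed (simp add: p)
  moreover from \<open>equivclp ?R q q'\<close> have "q' \<in> ipaths_between X dX i b c \<and>
    equivclp ?R (ipath_concat i p' q) (ipath_concat i p' q')"
  proof induction
    case (step y z)
    then have yz: "y \<in> ipaths_between X dX i b c" "z \<in> ipaths_between X dX i b c"
      using reparametrizes_between[of X dX i y z b c] reparametrizes_between[of X dX i z y b c]
      by blast+
    have "?R (ipath_concat i p' y) (ipath_concat i p' z) \<or>
      ?R (ipath_concat i p' z) (ipath_concat i p' y)"
      using step.hyps(2) reparametrizes_concat[OF dsp refl(1) _ p' yz(1)]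
        reparametrizes_concat[OF dsp refl(1) _ p' yz(2)] by blast
    then show ?case
      using step.IH yz(2) by (meson equivclp_trans r_into_equivclp converse_r_into_equivclp)
  qed (simp add: q)
  ultimately have "equivclp ?R (ipath_concat i p q) (ipath_concat i p' q')"
    by (meson equivclp_trans)
  then show ?thesis
    using ipath_concat_between[OF dsp p q] ipath_concat_between[OF dsp p' q']
    by (simp add: trace_rel_def ipaths_between_def)
qed

text \<open>By \<open>trace_rel_concat\<close> all pairs of representatives give one class, to which
  the union in \<open>trace_concat\<close> collapses.\<close>

lemma trace_concat_class:
  assumes dsp: "d_space X dX"
    and p: "p \<in> ipaths_between X dX i a b" and q: "q \<in> ipaths_between X dX i b c"
  shows "trace_concat X dX i (trace_rel X dX i `` {p}) (trace_rel X dX i `` {q}) =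
    trace_rel X dX i `` {ipath_concat i p q}"
proof -
  have "trace_rel X dX i `` {ipath_concat i p' q'} = trace_rel X dX i `` {ipath_concat i p q}"
    if "p' \<in> trace_rel X dX i `` {p}" "q' \<in> trace_rel X dX i `` {q}" for p' q'
    using that trace_rel_concat[OF dsp _ _ p q] by (intro trace_rel_class_eq[symmetric]) auto
  moreover have "p \<in> trace_rel X dX i `` {p}" "q \<in> trace_rel X dX i `` {q}"
    using p q by (simp_all add: ipaths_between_def trace_rel_def)
  ultimately show ?thesis
    unfolding trace_concat_def by blast
qed

lemma ipath_pull_concat:
  assumes "continuous_map (simplex_top (i - 1)) (simplex_top (j - 1)) \<alpha>"
  shows "ipath_pull i \<alpha> (ipath_concat j p q) = ipath_concat i (ipath_pull i \<alpha> p) (ipath_pull i \<alpha> q)"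
  using simplex_map_in[OF assms]
  by (auto simp: ipath_pull_def ipath_concat_def ipath_dom_def fun_eq_iff restrict_def)

lemma composableE:
  assumes "composable X dX i P Q"
  obtains a b c p q where "a \<in> topspace X" "b \<in> topspace X" "c \<in> topspace X"
    "p \<in> ipaths_between X dX i a b" "q \<in> ipaths_between X dX i b c"
    "P = trace_rel X dX i `` {p}" "Q = trace_rel X dX i `` {q}"
proof -
  obtain a b c where abc: "a \<in> topspace X" "b \<in> topspace X" "c \<in> topspace X"
    and PQ: "P \<in> traces_between X dX i a b" "Q \<in> traces_between X dX i b c"
    using assms by (auto simp: composable_def)
  obtain p where "p \<in> ipaths_between X dX i a b" "P = trace_rel X dX i `` {p}"
    using PQ(1) by (rule traces_betweenE)
  moreover obtain q where "q \<in> ipaths_between X dX i b c" "Q = trace_rel X dX i `` {q}"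
    using PQ(2) by (rule traces_betweenE)
  ultimately show thesis
    using that abc by blast
qed

lemma trace_concat_in_traces:
  assumes dsp: "d_space X dX" and "composable X dX i P Q"
  shows "trace_concat X dX i P Q \<in> traces X dX i"
  using assms(2)
proof (rule composableE)
  fix a b c p q
  assume a: "a \<in> topspace X" and c: "c \<in> topspace X"
    and p: "p \<in> ipaths_between X dX i a b" and q: "q \<in> ipaths_between X dX i b c"
    and PQ: "P = trace_rel X dX i `` {p}" "Q = trace_rel X dX i `` {q}"
  have "trace_concat X dX i P Q \<in> traces_between X dX i a c"
    unfolding PQ trace_concat_class[OF dsp p q]
    by (rule traces_betweenI[OF ipath_concat_between[OF dsp p q]])
  then show ?thesis
    unfolding traces_def by (intro UN_I[of a] UN_I[of c] a c)
qed

lemma trace_pull_concat: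
  assumes dsp: "d_space X dX"
    and \<alpha>: "continuous_map (simplex_top (i - 1)) (simplex_top (j - 1)) \<alpha>"
    and "composable X dX j P Q"
  shows "trace_pull X dX i \<alpha> (trace_concat X dX j P Q) =
    trace_concat X dX i (trace_pull X dX i \<alpha> P) (trace_pull X dX i \<alpha> Q)"
  using assms(3)
proof (rule composableE)
  fix a b c p q
  assume p: "p \<in> ipaths_between X dX j a b" and q: "q \<in> ipaths_between X dX j b c"
    and PQ: "P = trace_rel X dX j `` {p}" "Q = trace_rel X dX j `` {q}"
  have mem: "p \<in> ipaths X dX j" "q \<in> ipaths X dX j" "ipath_concat j p q \<in> ipaths X dX j"
    using p q ipath_concat_between[OF dsp p q] by (auto simp: ipaths_between_def)
  show ?thesis
    unfolding PQ trace_concat_class[OF dsp p q] mem[THEN trace_pull_class[OF \<alpha>]]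
      trace_concat_class[OF dsp ipath_pull_between[OF \<alpha> p] ipath_pull_between[OF \<alpha> q]]
      ipath_pull_concat[OF \<alpha>] ..
qed


section \<open>The simplicial algebra of a directed space\<close>

lemma RX_face_eq: "RX_face X dX n j = pushforward (trace_pull X dX n (simplical_face j))"
  by (simp add: fun_eq_iff RX_face_def module_face_def pushforward_def trace_face_eq)

text \<open>Degree \<open>n\<close> consists of \<open>(n + 1)\<close>-traces, so a degeneracy into
  degree \<open>n + 1\<close> produces \<open>(n + 2)\<close>-traces.\<close>

definition RX_degen :: "'a topology \<Rightarrow> (real \<Rightarrow> 'a) set \<Rightarrow> nat \<Rightarrow> nat \<Rightarrow>
    ('a trace \<Rightarrow>\<^sub>0 'r::{comm_ring,comm_monoid_mult}) \<Rightarrow> ('a trace \<Rightarrow>\<^sub>0 'r)" where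
  "RX_degen X dX n k = pushforward (trace_pull X dX (n + 2) (simplex_degen k))"

lemma face_degeneracy_algebra_RX:
  assumes dsp: "d_space X dX"
  shows "face_degeneracy_algebra
    (RX X dX :: nat \<Rightarrow> ('a trace \<Rightarrow>\<^sub>0 'r::{comm_ring,comm_monoid_mult}) set)
    (RX_face X dX) (RX_degen X dX) (RX_times X dX)"
proof -
  \<comment> \<open>The dimensions are written as path index minus one to match the pullback lemmas.
    For \<open>n = 0\<close> the truncated \<open>n - 1\<close> would not be a lower dimension,
    hence \<open>0 < n\<close>.\<close>
  have face: "continuous_map (simplex_top (n - 1)) (simplex_top (n + 1 - 1)) (simplical_face j)"
    if "j \<le> n" "0 < n" for n j
    using continuous_map_simplical_face[of j "n - 1"] that by simp
  have degen: "continuous_map (simplex_top (n + 2 - 1)) (simplex_top (n + 1 - 1)) (simplex_degen k)"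
    if "k \<le> n" for n k
    using continuous_map_simplex_degen[of k n] that by simp
  \<comment> \<open>A degeneracy followed by a face, or the reverse, is a single pullback along a
    composite map. Each simplicial identity then becomes an equality of maps of simplices.\<close>
  have face_degen: "RX_face X dX (Suc n) j (RX_degen X dX n k x) =
      pushforward (trace_pull X dX (n + 1) (simplex_degen k \<circ> simplical_face j)) x"
    if "x \<in> RX X dX n" "k \<le> n" "j \<le> Suc n" for n j k and x :: "'a trace \<Rightarrow>\<^sub>0 'r"
    using pushforward_trace_pull_compose[OF _ degen[OF that(2)], of "n + 1" "simplical_face j" x X dX]
      face[OF that(3)] that(1)
    by (simp add: RX_face_eq RX_degen_def RX_def)
  have degen_face: "RX_degen X dX (n - 1) k (RX_face X dX n j x) =
      pushforward (trace_pull X dX (n + 1) (simplical_face j \<circ> simplex_degen k)) x"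
    if "x \<in> RX X dX n" "k \<le> n - 1" "j \<le> n" "0 < n" for n j k and x :: "'a trace \<Rightarrow>\<^sub>0 'r"
    using pushforward_trace_pull_compose[OF _ face[OF that(3,4)], of "n + 1" "simplex_degen k" x X dX]
      degen[OF that(2)] that(1,4)
    by (simp add: RX_face_eq RX_degen_def RX_def)
  show ?thesis
  proof
    fix n j k and x y :: "'a trace \<Rightarrow>\<^sub>0 'r"
    show "0 \<in> RX X dX n"
      by (simp add: RX_def trace_module_def)
    show "x - y \<in> RX X dX n" if "x \<in> RX X dX n" "y \<in> RX X dX n"
      using that keys_diff[of x y] by (auto simp: RX_def trace_module_def)
    show "RX_times X dX n x y \<in> RX X dX n" if "x \<in> RX X dX n" "y \<in> RX X dX n"
      using keys_trace_times[of X dX "n + 1" x y] trace_concat_in_traces[OF dsp]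
      by (fastforce simp: RX_def RX_times_def trace_module_def)
    show "RX_times X dX n 0 y = 0" "RX_times X dX n x 0 = 0"
      by (simp_all add: RX_times_def trace_times_zero)
    show "RX_face X dX n j (x - y) = RX_face X dX n j x - RX_face X dX n j y"
      by (simp add: RX_face_eq pushforward_diff)
    show "RX_degen X dX n k (x - y) = RX_degen X dX n k x - RX_degen X dX n k y"
      by (simp add: RX_degen_def pushforward_diff)
    show "RX_face X dX (Suc n) j (RX_times X dX (Suc n) x y) =
        RX_times X dX n (RX_face X dX (Suc n) j x) (RX_face X dX (Suc n) j y)"
      if "x \<in> RX X dX (Suc n)" "y \<in> RX X dX (Suc n)" "j \<le> Suc n"
    proof -
      have *: "continuous_map (simplex_top (Suc n - 1)) (simplex_top (Suc (Suc n) - 1)) (simplical_face j)"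
        using face[OF that(3)] by simp
      have mem: "P \<in> traces X dX (Suc (Suc n))"
        if "P \<in> Poly_Mapping.keys x \<or> P \<in> Poly_Mapping.keys y" for P
        using that \<open>x \<in> _\<close> \<open>y \<in> _\<close> by (auto simp: RX_def trace_module_def)
      let ?f = "trace_pull X dX (Suc n) (simplical_face j)"
      have "pushforward ?f (trace_times X dX (Suc (Suc n)) x y) =
          trace_times X dX (Suc n) (pushforward ?f x) (pushforward ?f y)"
        by (intro pushforward_trace_times composable_pull[OF *] trace_pull_concat[OF dsp *] mem) auto
      then show ?thesis
        by (simp add: RX_face_eq RX_times_def)
    qed
    show "RX_degen X dX n k x \<in> RX X dX (Suc n)" if "x \<in> RX X dX n" "k \<le> n"
      using pushforward_trace_pull_closed[OF degen[OF that(2)]] that(1)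
      by (simp add: RX_degen_def RX_def)
    show "RX_face X dX (Suc n) j (RX_degen X dX n k x) =
        RX_degen X dX (n - 1) (k - 1) (RX_face X dX n j x)"
      if "x \<in> RX X dX n" "j < k" "k \<le> n"
    proof -
      \<comment> \<open>\<open>j < k \<le> n\<close> forces \<open>n\<close> and \<open>k\<close> to
        be positive, so the truncated subtractions are genuine.\<close>
      have "k - 1 \<le> n - 1" "j \<le> n" "0 < n" "j \<le> Suc n"
        using that by auto
      then show ?thesis
        unfolding degen_face[OF that(1) \<open>k - 1 \<le> n - 1\<close> \<open>j \<le> n\<close> \<open>0 < n\<close>]
          face_degen[OF that(1,3) \<open>j \<le> Suc n\<close>]
        by (simp add: o_def simplex_degen_face_less[OF that(2)])
    qed
    show "RX_face X dX (Suc n) k (RX_degen X dX n k x) = x" if "x \<in> RX X dX n" "k \<le> n"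
      using that pushforward_trace_pull_ident[of x X dX "n + 1"]
      by (simp add: face_degen o_def simplex_degen_face_same RX_def)
    show "RX_face X dX (Suc n) (Suc k) (RX_degen X dX n k x) = x" if "x \<in> RX X dX n" "k \<le> n"
      using that pushforward_trace_pull_ident[of x X dX "n + 1"]
      by (simp add: face_degen o_def simplex_degen_face_Suc RX_def)
    show "RX_face X dX (Suc n) j (RX_degen X dX n k x) =
        RX_degen X dX (n - 1) k (RX_face X dX n (j - 1) x)"
      if "x \<in> RX X dX n" "Suc k < j" "j \<le> Suc n"
    proof -
      have "k \<le> n - 1" "j - 1 \<le> n" "0 < n" "k \<le> n"
        using that by auto
      then show ?thesis
        unfolding degen_face[OF that(1) \<open>k \<le> n - 1\<close> \<open>j - 1 \<le> n\<close> \<open>0 < n\<close>]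
          face_degen[OF that(1) \<open>k \<le> n\<close> that(3)]
        by (simp add: o_def simplex_degen_face_greater[OF that(2)])
    qed
  qed
qed

theorem lemma9:
  fixes X :: "'a topology" and dX :: "(real \<Rightarrow> 'a) set" and n :: nat
    and x y :: "('a trace \<Rightarrow>\<^sub>0 'r::{comm_ring,comm_monoid_mult}) set"
  assumes "d_space X dX" and "n \<ge> 2"
    and "x \<in> HA X dX n" and "y \<in> HA X dX n"
  shows "HA_times X dX n x y = HA_zero X dX n"
proof -
  \<comment> \<open>\<open>HA\<close> of index \<open>n\<close> is homology in degree
    \<open>n - 1\<close>, so \<open>n \<ge> 2\<close> is exactly the positivity of the degree that
    the product argument requires.\<close>
  obtain m where "n - 1 = Suc m"
    using assms(2) by (cases "n - 1") auto
  then show ?thesis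
    using face_degeneracy_algebra.moore_homology_times_zero[OF face_degeneracy_algebra_RX[OF assms(1)]]
      assms(3,4)
    by (simp add: HA_def HA_times_def HA_zero_def)
qed

end
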